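(* Let $\hat g_N^{\pi(R)}$ be the gain of the augmented $N$-reel system under the random policy $\pi(R)$, and let $(g_1,h_1)$ be any solution of the single-reel Bellman equation $$h_1(w)=-g_1+\sum_{x'}p(x')\big(c(w,x')+h_1(e(w,x'))\big)\quad\text{for all }w\in\mathbf W.$$ For any $\theta\in\mathbb R$, the function $$\hat h_N^{\pi(R)}(w_1,\dots,w_N,x)=\frac1N\sum_{n=1}^N\Big(c(w_n,x)+h_1(e(w_n,x))+(N-1)h_1(w_n)\Big)+\theta$$ on $\mathbf W^N\times\mathbf X$ is a solution to the Bellman equation of the augmented $N$-reel system under $\pi(R)$: $$\hat h_N^{\pi(R)}(w_1,\dots,w_N,x)=-\hat g_N^{\pi(R)}+\frac1N\sum_{n=1}^N\Big[c(w_n,x)+\sum_{x'}p(x')\,\hat h_N^{\pi(R)}(w_1,\dots,e(w_n,x),\dots,w_N,x')\Big].$$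
   Context: Let $B$ and $N$ be positive integers ($B$ is the weight of a new reel, $N$ the number of reels), $\mathbf W=\{0,1,\dots,B-1\}$ the set of reel weights and $\mathbf X=\{1,\dots,B\}$ the set of component weights. Component weights are i.i.d. with a probability mass function $p$ on $\mathbf X$. For $w\in\mathbf W$, $x\in\mathbf X$ put $e(w,x)=w-x$ if $w\ge x$ and $e(w,x)=B-x$ otherwise (reel weight after assigning a component of weight $x$); $c(w,x)=0$ if $w\ge x$ and $c(w,x)=w$ otherwise (discarded weight, the one-step cost). Augmented $N$-reel system under $\pi(R)$: the state is $(w_1,\dots,w_N,x)\in\mathbf W^N\times\mathbf X$, where $x$ is the weight of the current component, observed before the reel is chosen. In each period a reel $n\in\{1,\dots,N\}$ is chosen uniformly at random, independently of everything else, cost $c(w_n,x)$ is incurred, $w_n$ is replaced by $e(w_n,x)$ (other reels unchanged), and the next component weight $x'\sim p$ is drawn. Its gain is $\hat g_N^{\pi(R)}=\lim_{T\to\infty}\frac1T\sum_{t=1}^T\mathbb E[\text{cost incurred in period }t]$. In $(w_1,\dots,e(w_n,x),\dots,w_N,x')$ only the $n$-th reel entry is replaced. Sums over $x'$ run over $\mathbf X$. *)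

theory Defs
  imports "HOL-Probability.Probability"
begin

definition reel_weights :: "nat \<Rightarrow> nat set" where
  "reel_weights B = {0..<B}"

definition component_weights :: "nat \<Rightarrow> nat set" where
  "component_weights B = {1..B}"

(* Subtraction on nat does not truncate here as long as x <= B. *)
definition next_weight :: "nat \<Rightarrow> nat \<Rightarrow> nat \<Rightarrow> nat" where
  "next_weight B w x = (if x \<le> w then w - x else B - x)"

definition discard_cost :: "nat \<Rightarrow> nat \<Rightarrow> real" where
  "discard_cost w x = (if x \<le> w then 0 else real w)"

definition single_bellman ::
  "nat \<Rightarrow> nat pmf \<Rightarrow> real \<Rightarrow> (nat \<Rightarrow> real) \<Rightarrow> bool" where
  "single_bellman B p g h \<longleftrightarrow>
     (\<forall>w\<in>reel_weights B.
        h w = - g + (\<Sum>x'\<in>component_weights B.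
                       pmf p x' * (discard_cost w x' + h (next_weight B w x'))))"

text \<open>
  A state (w_1, ..., w_N, x) of the augmented system is a pair consisting of the list of
  the N reel weights and the weight of the current component; reels are numbered from 0.
\<close>

type_synonym aug_state = "nat list \<times> nat"

definition aug_states :: "nat \<Rightarrow> nat \<Rightarrow> aug_state set" where
  "aug_states B N =
     {ws. length ws = N \<and> set ws \<subseteq> reel_weights B} \<times> component_weights B"

text \<open>
  Joint law of the cost incurred in one period and the state at the next period, given the
  current state, under the random policy.  The reel n and the next component x' are drawn
  independently, and the same n determines both the cost and the transition.
\<close>

definition random_period :: "nat \<Rightarrow> nat \<Rightarrow> nat pmf \<Rightarrow> aug_state \<Rightarrow> (real \<times> aug_state) pmf" where
  "random_period B N p = (\<lambda>(ws, x).
     bind_pmf (pmf_of_set {..<N}) (\<lambda>n.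
     bind_pmf p (\<lambda>x'.
     return_pmf (discard_cost (ws ! n) x, (ws[n := next_weight B (ws ! n) x], x')))))"

text \<open>Law of the state after t periods, when the initial state has law \<open>\<mu>\<close>.\<close>

primrec state_law :: "nat \<Rightarrow> nat \<Rightarrow> nat pmf \<Rightarrow> aug_state pmf \<Rightarrow> nat \<Rightarrow> aug_state pmf" where
  "state_law B N p \<mu> 0 = \<mu>"
| "state_law B N p \<mu> (Suc t) =
     map_pmf snd (bind_pmf (state_law B N p \<mu> t) (random_period B N p))"

text \<open>Periods are numbered from 1, so period t starts after t - 1 transitions.\<close>

definition expected_cost :: "nat \<Rightarrow> nat \<Rightarrow> nat pmf \<Rightarrow> aug_state pmf \<Rightarrow> nat \<Rightarrow> real" where
  "expected_cost B N p \<mu> t =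
     measure_pmf.expectation
       (bind_pmf (state_law B N p \<mu> (t - 1)) (random_period B N p)) fst"

definition average_cost :: "nat \<Rightarrow> nat \<Rightarrow> nat pmf \<Rightarrow> aug_state pmf \<Rightarrow> nat \<Rightarrow> real" where
  "average_cost B N p \<mu> T = 1 / real T * (\<Sum>t = 1..T. expected_cost B N p \<mu> t)"

definition random_gain :: "nat \<Rightarrow> nat \<Rightarrow> nat pmf \<Rightarrow> aug_state pmf \<Rightarrow> real" where
  "random_gain B N p \<mu> = lim (average_cost B N p \<mu>)"

definition random_bellman ::
  "nat \<Rightarrow> nat \<Rightarrow> nat pmf \<Rightarrow> real \<Rightarrow> (aug_state \<Rightarrow> real) \<Rightarrow> bool" where
  "random_bellman B N p g h \<longleftrightarrow>
     (\<forall>(ws, x)\<in>aug_states B N.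
        h (ws, x) = - g + 1 / real N *
          (\<Sum>n<N. discard_cost (ws ! n) x
             + (\<Sum>x'\<in>component_weights B.
                  pmf p x' * h (ws[n := next_weight B (ws ! n) x], x'))))"

definition aug_bias :: "nat \<Rightarrow> nat \<Rightarrow> (nat \<Rightarrow> real) \<Rightarrow> real \<Rightarrow> aug_state \<Rightarrow> real" where
  "aug_bias B N h \<theta> = (\<lambda>(ws, x).
     1 / real N *
       (\<Sum>n<N. discard_cost (ws ! n) x + h (next_weight B (ws ! n) x)
                + (real N - 1) * h (ws ! n)) + \<theta>)"

end

theory Submission
  imports Defs
begin

text \<open>
  Two independent facts combine.  First, the proposed bias solves the Bellman equation of the
  augmented system with the single-reel constant \<open>g\<^sub>1\<close> in place of the gain
  (\<open>random_bellman_aug_bias\<close>): averaging the bias over the next component \<open>x'\<close> turns the summand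
  of each reel \<open>m\<close> into \<open>N * h\<^sub>1 (w\<^sub>m) + g\<^sub>1\<close>, by the single-reel equation, so that the averaged bias
  is the separable function \<open>(\<Sum>m. h\<^sub>1 (w\<^sub>m)) + g\<^sub>1 + \<theta>\<close>, in which moving one reel changes one term.

  Secondly, the constant in such an equation is always the gain (\<open>average_cost_tendsto\<close>).  Taking
  expectations along the chain, the equation says that the expected cost of a period is the
  constant plus the decrease of the expected bias over that period.  The sum over \<open>T\<close> periods
  telescopes, and the remaining boundary terms are bounded because the state space is finite, so
  they vanish after division by \<open>T\<close>.  This gives convergence for every initial law, and it
  identifies the limit with \<open>g\<^sub>1\<close>.
\<close>

section \<open>The finite state space\<close>

lemma next_weight_mem:
  assumes "w \<in> reel_weights B" "x \<in> component_weights B"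
  shows "next_weight B w x \<in> reel_weights B"
  using assms by (auto simp: next_weight_def reel_weights_def component_weights_def)

lemma nth_reel_weights:
  assumes "(ws, x) \<in> aug_states B N" "n < N"
  shows "ws ! n \<in> reel_weights B"
  using assms by (auto simp: aug_states_def)

lemma aug_states_update:
  assumes "(ws, x) \<in> aug_states B N" "n < N" "x' \<in> component_weights B"
  shows "(ws[n := next_weight B (ws ! n) x], x') \<in> aug_states B N"
proof -
  have "next_weight B (ws ! n) x \<in> reel_weights B"
    using assms by (intro next_weight_mem nth_reel_weights) (auto simp: aug_states_def)
  then show ?thesis
    using assms set_update_subset_insert[of ws n "next_weight B (ws ! n) x"]
    by (auto simp: aug_states_def)
qed

lemma finite_aug_states: "finite (aug_states B N)"
proof -
  have "finite {ws. set ws \<subseteq> reel_weights B \<and> length ws = N}"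
    by (intro finite_lists_length_eq) (simp add: reel_weights_def)
  then show ?thesis
    by (simp add: aug_states_def component_weights_def conj_commute)
qed

lemma finite_set_pmf_components:
  assumes "set_pmf p \<subseteq> component_weights B"
  shows "finite (set_pmf p)"
  using assms by (rule finite_subset) (simp add: component_weights_def)

lemma sum_pmf_components:
  assumes "set_pmf p \<subseteq> component_weights B"
  shows "(\<Sum>x\<in>component_weights B. pmf p x) = 1"
  using assms by (intro sum_pmf_eq_1) (simp_all add: component_weights_def)

section \<open>The Bellman equation as an expectation over one period\<close>

lemma set_pmf_random_period:
  assumes "N > 0"
  shows "set_pmf (random_period B N p (ws, x)) =
    (\<Union>n\<in>{..<N}. \<Union>x'\<in>set_pmf p.
       {(discard_cost (ws ! n) x, (ws[n := next_weight B (ws ! n) x], x'))})"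
  using assms by (simp add: random_period_def set_pmf_of_set lessThan_empty_iff)

lemma finite_set_pmf_random_period:
  assumes "N > 0" "set_pmf p \<subseteq> component_weights B"
  shows "finite (set_pmf (random_period B N p s))"
  using assms finite_set_pmf_components[OF assms(2)]
  by (cases s) (simp add: set_pmf_random_period)

lemma random_period_closed:
  assumes "N > 0" "set_pmf p \<subseteq> component_weights B" "s \<in> aug_states B N"
  shows "snd ` set_pmf (random_period B N p s) \<subseteq> aug_states B N"
proof (cases s)
  case (Pair ws x)
  then show ?thesis
    using assms by (auto simp: set_pmf_random_period intro!: aug_states_update)
qed

lemma expectation_random_period:
  fixes f :: "real \<times> aug_state \<Rightarrow> real"
  assumes "N > 0" "set_pmf p \<subseteq> component_weights B"
  shows "measure_pmf.expectation (random_period B N p (ws, x)) f =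
    1 / real N * (\<Sum>n<N. \<Sum>x'\<in>component_weights B.
      pmf p x' * f (discard_cost (ws ! n) x, (ws[n := next_weight B (ws ! n) x], x')))"
proof -
  have fin: "finite (set_pmf p)"
    by (rule finite_set_pmf_components[OF assms(2)])
  have finX: "finite (component_weights B)"
    by (simp add: component_weights_def)
  show ?thesis
    unfolding random_period_def prod.case
    using assms(1) fin
    by (subst pmf_expectation_bind_pmf_of_set)
       (auto simp: lessThan_empty_iff sum_distrib_left divide_inverse
             pmf_expectation_bind[OF finX _ assms(2)])
qed

text \<open>
  The cost does not depend on the next component, so the weights \<open>p\<close> can be summed out of it; this
  is what allows cost and next bias to be put under a single expectation.
\<close>
lemma random_bellman_expectation:
  assumes "N > 0" "set_pmf p \<subseteq> component_weights B"
    and "random_bellman B N p g h" "s \<in> aug_states B N"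
  shows "measure_pmf.expectation (random_period B N p s) (\<lambda>y. fst y + h (snd y)) = h s + g"
proof (cases s)
  case (Pair ws x)
  have "h (ws, x) = - g + 1 / real N *
          (\<Sum>n<N. discard_cost (ws ! n) x
             + (\<Sum>x'\<in>component_weights B.
                  pmf p x' * h (ws[n := next_weight B (ws ! n) x], x')))"
    using assms(3,4) unfolding random_bellman_def Pair by blast
  then show ?thesis
    using assms(1,2)
    by (simp add: Pair expectation_random_period distrib_left sum.distrib
          sum_distrib_right[symmetric] sum_pmf_components)
qed

section \<open>The constant in a Bellman equation is the gain\<close>

lemma set_pmf_state_law:
  assumes "N > 0" "set_pmf p \<subseteq> component_weights B" "set_pmf \<mu> \<subseteq> aug_states B N"
  shows "set_pmf (state_law B N p \<mu> t) \<subseteq> aug_states B N"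
proof (induction t)
  case 0
  then show ?case using assms(3) by simp
next
  case (Suc t)
  then show ?case
    using random_period_closed[OF assms(1,2)] by (fastforce simp: set_bind_pmf)
qed

lemma expectation_state_law:
  fixes h :: "aug_state \<Rightarrow> real"
  assumes "N > 0" "set_pmf p \<subseteq> component_weights B" "set_pmf \<mu> \<subseteq> aug_states B N"
  shows "measure_pmf.expectation (state_law B N p \<mu> t) h =
    (\<Sum>s\<in>aug_states B N. pmf (state_law B N p \<mu> t) s * h s)"
  using set_pmf_state_law[OF assms, of t]
  by (subst integral_measure_pmf[OF finite_aug_states[of B N]]) auto

text \<open>
  This is the increment of the telescoping sum: averaging the Bellman equation over the law of the
  state at time \<open>t\<close> relates the expected biases at times \<open>t\<close> and \<open>Suc t\<close>.
\<close>
lemma expected_cost_Suc: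
  assumes "N > 0" "set_pmf p \<subseteq> component_weights B" "set_pmf \<mu> \<subseteq> aug_states B N"
    and "random_bellman B N p g h"
  shows "expected_cost B N p \<mu> (Suc t) =
    g + measure_pmf.expectation (state_law B N p \<mu> t) h
      - measure_pmf.expectation (state_law B N p \<mu> (Suc t)) h"
proof -
  let ?S = "state_law B N p \<mu> t" and ?R = "random_period B N p" and ?A = "aug_states B N"
  have supp: "set_pmf ?S \<subseteq> ?A"
    by (rule set_pmf_state_law[OF assms(1-3)])
  have finS: "finite (set_pmf ?S)"
    using supp finite_aug_states by (rule finite_subset)
  have finR: "finite (set_pmf (?R s))" for s
    by (rule finite_set_pmf_random_period[OF assms(1,2)])
  have "finite (set_pmf (bind_pmf ?S ?R))"
    using finS finR by (simp add: set_bind_pmf)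
  then have int: "integrable (bind_pmf ?S ?R) f" for f :: "real \<times> aug_state \<Rightarrow> real"
    by (rule integrable_measure_pmf_finite)
  have "measure_pmf.expectation (bind_pmf ?S ?R) (\<lambda>y. fst y + h (snd y)) =
      (\<Sum>s\<in>?A. pmf ?S s * measure_pmf.expectation (?R s) (\<lambda>y. fst y + h (snd y)))"
    by (subst pmf_expectation_bind[OF finite_aug_states finR supp]) simp
  also have "\<dots> = (\<Sum>s\<in>?A. pmf ?S s * (h s + g))"
    by (intro sum.cong refl) (simp add: random_bellman_expectation[OF assms(1,2,4)])
  also have "\<dots> = (\<Sum>s\<in>?A. pmf ?S s * h s) + g"
    using sum_pmf_eq_1[OF finite_aug_states supp]
    by (simp add: distrib_left sum.distrib sum_distrib_right[symmetric])
  also have "(\<Sum>s\<in>?A. pmf ?S s * h s) = measure_pmf.expectation ?S h"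
    by (rule expectation_state_law[OF assms(1-3), symmetric])
  finally have "measure_pmf.expectation (bind_pmf ?S ?R) fst
      + measure_pmf.expectation (bind_pmf ?S ?R) (\<lambda>y. h (snd y))
      = measure_pmf.expectation ?S h + g"
    using int by simp
  then show ?thesis
    by (simp add: expected_cost_def)
qed

lemma sum_expected_cost:
  assumes "N > 0" "set_pmf p \<subseteq> component_weights B" "set_pmf \<mu> \<subseteq> aug_states B N"
    and "random_bellman B N p g h"
  shows "(\<Sum>t = 1..T. expected_cost B N p \<mu> t) =
    real T * g + measure_pmf.expectation \<mu> h
      - measure_pmf.expectation (state_law B N p \<mu> T) h"
proof (induction T)
  case 0
  show ?case by simp
next
  case (Suc T)
  then show ?case
    using expected_cost_Suc[OF assms, of T] by (simp add: algebra_simps del: state_law.simps)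
qed

lemma expectation_state_law_bounded:
  fixes h :: "aug_state \<Rightarrow> real"
  assumes "N > 0" "set_pmf p \<subseteq> component_weights B" "set_pmf \<mu> \<subseteq> aug_states B N"
  shows "\<bar>measure_pmf.expectation (state_law B N p \<mu> t) h\<bar> \<le> (\<Sum>s\<in>aug_states B N. \<bar>h s\<bar>)"
proof -
  let ?S = "state_law B N p \<mu> t"
  have "measure_pmf.expectation ?S h = (\<Sum>s\<in>aug_states B N. pmf ?S s * h s)"
    by (rule expectation_state_law[OF assms])
  also have "\<bar>\<dots>\<bar> \<le> (\<Sum>s\<in>aug_states B N. \<bar>pmf ?S s * h s\<bar>)"
    by (rule sum_abs)
  also have "\<dots> \<le> (\<Sum>s\<in>aug_states B N. \<bar>h s\<bar>)"
    by (intro sum_mono) (simp add: abs_mult mult_left_le_one_le pmf_le_1)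
  finally show ?thesis .
qed

theorem average_cost_tendsto:
  assumes "N > 0" "set_pmf p \<subseteq> component_weights B" "set_pmf \<mu> \<subseteq> aug_states B N"
    and "random_bellman B N p g h"
  shows "average_cost B N p \<mu> \<longlonglongrightarrow> g"
proof -
  let ?E = "\<lambda>t. measure_pmf.expectation (state_law B N p \<mu> t) h"
  let ?K = "\<Sum>s\<in>aug_states B N. \<bar>h s\<bar>"
  have "(\<lambda>T. 1 / real T * (?E 0 - ?E T)) \<longlonglongrightarrow> 0"
  proof (rule Lim_null_comparison)
    have "\<bar>?E 0 - ?E T\<bar> \<le> 2 * ?K" for T
      using expectation_state_law_bounded[OF assms(1-3), of 0 h]
        expectation_state_law_bounded[OF assms(1-3), of T h]
      by linarith
    then show "\<forall>\<^sub>F T in sequentially. norm (1 / real T * (?E 0 - ?E T)) \<le> 2 * ?K / real T"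
      by (intro always_eventually allI) (simp add: abs_mult divide_right_mono)
    show "(\<lambda>T. 2 * ?K / real T) \<longlonglongrightarrow> 0"
      by (rule lim_const_over_n)
  qed
  then have "(\<lambda>T. g + 1 / real T * (?E 0 - ?E T)) \<longlonglongrightarrow> g"
    using tendsto_add[OF tendsto_const[of g]] by fastforce
  moreover have "\<forall>\<^sub>F T in sequentially. g + 1 / real T * (?E 0 - ?E T) = average_cost B N p \<mu> T"
    using eventually_gt_at_top[of 0]
  proof eventually_elim
    case (elim T)
    then show ?case
      unfolding average_cost_def sum_expected_cost[OF assms]
      by (simp add: field_simps)
  qed
  ultimately show ?thesis
    by (rule Lim_transform_eventually)
qed

section \<open>The bias built from the single-reel solution\<close>

lemma sum_list_update:
  fixes f :: "'a \<Rightarrow> 'b::ab_group_add"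
  assumes "length ws = N" "n < N"
  shows "(\<Sum>m<N. f (ws[n := v] ! m)) = (\<Sum>m<N. f (ws ! m)) - f (ws ! n) + f v"
proof -
  have "(\<Sum>m<N. f (ws[n := v] ! m)) = f v + (\<Sum>m\<in>{..<N} - {n}. f (ws[n := v] ! m))"
    using assms by (simp add: sum.remove[of "{..<N}" n])
  also have "(\<Sum>m\<in>{..<N} - {n}. f (ws[n := v] ! m)) = (\<Sum>m\<in>{..<N} - {n}. f (ws ! m))"
    by (intro sum.cong) auto
  also have "\<dots> = (\<Sum>m<N. f (ws ! m)) - f (ws ! n)"
    using assms by (simp add: sum_diff1)
  finally show ?thesis by (simp add: algebra_simps)
qed

text \<open>
  Averaging out the component separates the bias over the reels: the single-reel equation replaces
  the expected cost and next value of each reel \<open>m\<close> by \<open>h\<^sub>1 (w\<^sub>m) + g\<^sub>1\<close>, which the term with weight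
  \<open>N - 1\<close> completes to \<open>N * h\<^sub>1 (w\<^sub>m) + g\<^sub>1\<close>.
\<close>
lemma sum_components_aug_bias:
  assumes "N > 0" "set_pmf p \<subseteq> component_weights B" "single_bellman B p g1 h1"
    and "length ws = N" "set ws \<subseteq> reel_weights B"
  shows "(\<Sum>x\<in>component_weights B. pmf p x * aug_bias B N h1 \<theta> (ws, x)) =
    (\<Sum>m<N. h1 (ws ! m)) + g1 + \<theta>"
proof -
  let ?X = "component_weights B"
  let ?F = "\<lambda>m x. discard_cost (ws ! m) x + h1 (next_weight B (ws ! m) x)"
  have single: "(\<Sum>x\<in>?X. pmf p x * ?F m x) = h1 (ws ! m) + g1" if "m < N" for m
  proof -
    have "ws ! m \<in> reel_weights B"
      using assms(4,5) that by auto
    then show ?thesis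
      using assms(3) by (auto simp: single_bellman_def)
  qed
  have "(\<Sum>x\<in>?X. pmf p x * aug_bias B N h1 \<theta> (ws, x)) =
      (\<Sum>x\<in>?X. 1 / real N * (\<Sum>m<N. pmf p x * (?F m x + (real N - 1) * h1 (ws ! m)))
        + pmf p x * \<theta>)"
    unfolding aug_bias_def prod.case
    by (intro sum.cong refl) (simp add: distrib_left sum_distrib_left mult.assoc)
  also have "\<dots> = 1 / real N *
      (\<Sum>x\<in>?X. \<Sum>m<N. pmf p x * (?F m x + (real N - 1) * h1 (ws ! m))) + \<theta>"
    by (simp add: sum.distrib sum_distrib_left[symmetric] sum_distrib_right[symmetric]
          sum_pmf_components[OF assms(2)] sum_divide_distrib[symmetric])
  also have "(\<Sum>x\<in>?X. \<Sum>m<N. pmf p x * (?F m x + (real N - 1) * h1 (ws ! m))) =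
      (\<Sum>m<N. \<Sum>x\<in>?X. pmf p x * (?F m x + (real N - 1) * h1 (ws ! m)))"
    by (rule sum.swap)
  also have "\<dots> = (\<Sum>m<N. real N * h1 (ws ! m) + g1)"
  proof (intro sum.cong refl)
    fix m assume "m \<in> {..<N}"
    have "(\<Sum>x\<in>?X. pmf p x * (?F m x + (real N - 1) * h1 (ws ! m))) =
        (\<Sum>x\<in>?X. pmf p x * ?F m x) + (\<Sum>x\<in>?X. pmf p x) * ((real N - 1) * h1 (ws ! m))"
      unfolding sum_distrib_right sum.distrib[symmetric] distrib_left ..
    also have "\<dots> = h1 (ws ! m) + g1 + (real N - 1) * h1 (ws ! m)"
      using \<open>m \<in> {..<N}\<close> by (simp add: single sum_pmf_components[OF assms(2)])
    finally show "(\<Sum>x\<in>?X. pmf p x * (?F m x + (real N - 1) * h1 (ws ! m))) =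
        real N * h1 (ws ! m) + g1"
      by (simp add: algebra_simps)
  qed
  also have "\<dots> = real N * ((\<Sum>m<N. h1 (ws ! m)) + g1)"
    by (simp add: sum.distrib sum_distrib_left[symmetric] distrib_left)
  finally show ?thesis
    using assms(1) by simp
qed

text \<open>
  With \<open>S = (\<Sum>m. h\<^sub>1 (w\<^sub>m))\<close>, choosing reel \<open>n\<close> leads to the averaged bias
  \<open>S - h\<^sub>1 (w\<^sub>n) + h\<^sub>1 (e (w\<^sub>n, x)) + g\<^sub>1 + \<theta>\<close>.  Averaging over \<open>n\<close>, the first two terms give
  \<open>(N - 1) / N * S\<close>, which explains the coefficient \<open>N - 1\<close> in the bias.
\<close>
lemma random_bellman_aug_bias:
  assumes "N > 0" "set_pmf p \<subseteq> component_weights B" "single_bellman B p g1 h1"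
  shows "random_bellman B N p g1 (aug_bias B N h1 \<theta>)"
  unfolding random_bellman_def
proof (intro ballI, clarify)
  fix ws x assume st: "(ws, x) \<in> aug_states B N"
  let ?e = "\<lambda>n. next_weight B (ws ! n) x" and ?c = "\<lambda>n. discard_cost (ws ! n) x"
  let ?S = "\<Sum>m<N. h1 (ws ! m)"
  have len: "length ws = N"
    using st by (simp add: aug_states_def)
  have next_bias: "(\<Sum>x'\<in>component_weights B. pmf p x' * aug_bias B N h1 \<theta> (ws[n := ?e n], x'))
      = ?S - h1 (ws ! n) + h1 (?e n) + g1 + \<theta>" if "n < N" for n
  proof -
    have "set (ws[n := ?e n]) \<subseteq> reel_weights B"
      using aug_states_update[OF st that, of x] st by (auto simp: aug_states_def)
    then show ?thesis
      using len that
      by (simp add: sum_components_aug_bias[OF assms] sum_list_update)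
  qed
  have "(\<Sum>n<N. ?c n + (\<Sum>x'\<in>component_weights B.
          pmf p x' * aug_bias B N h1 \<theta> (ws[n := ?e n], x')))
      = (\<Sum>n<N. ?c n + (?S - h1 (ws ! n) + h1 (?e n) + g1 + \<theta>))"
    by (intro sum.cong refl) (simp add: next_bias)
  also have "\<dots> = (\<Sum>n<N. ?c n + h1 (?e n)) + (real N - 1) * ?S + real N * (g1 + \<theta>)"
    by (simp add: sum.distrib sum_subtractf algebra_simps)
  also have "\<dots> = (\<Sum>n<N. ?c n + h1 (?e n) + (real N - 1) * h1 (ws ! n)) + real N * (g1 + \<theta>)"
    by (simp add: sum.distrib sum_distrib_left)
  finally show "aug_bias B N h1 \<theta> (ws, x) = - g1 + 1 / real N *
      (\<Sum>n<N. ?c n + (\<Sum>x'\<in>component_weights B.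
          pmf p x' * aug_bias B N h1 \<theta> (ws[n := ?e n], x')))"
    using assms(1) by (simp add: aug_bias_def add_divide_distrib)
qed

theorem corollary4p4p1:
  fixes B N :: nat
    and p :: "nat pmf"
    and \<mu> :: "aug_state pmf"
    and g1 \<theta> :: real
    and h1 :: "nat \<Rightarrow> real"
  assumes "B > 0" and "N > 0"
    and "set_pmf p \<subseteq> component_weights B"
    and "set_pmf \<mu> \<subseteq> aug_states B N"
    and "single_bellman B p g1 h1"
  shows "convergent (average_cost B N p \<mu>) \<and>
         random_bellman B N p (random_gain B N p \<mu>) (aug_bias B N h1 \<theta>)"
proof -
  have bellman: "random_bellman B N p g1 (aug_bias B N h1 \<theta>)"
    by (rule random_bellman_aug_bias[OF assms(2,3,5)])
  have lim: "average_cost B N p \<mu> \<longlonglongrightarrow> g1"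
    by (rule average_cost_tendsto[OF assms(2-4) bellman])
  then have "random_gain B N p \<mu> = g1"
    by (simp add: random_gain_def limI)
  then show ?thesis
    using bellman lim by (auto simp: convergent_def)
qed

end
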